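(* Let $(H,T)$ be a graft with $|T|\le 4$. Suppose that every vertex of $H$ not in $T$ has even degree and that all the vertices in $T$ have degrees of the same parity. Then the maximum number of pairwise (edge-)disjoint $T$-joins is equal to the minimum size of a $T$-cut.
   Context: Graphs may have loops and parallel edges. A graft is a pair $(H,T)$ where $H$ is a graph, $T\subseteq V(H)$ and $|T|$ is even. A $T$-join is an edge subset $J\subseteq E(H)$ that induces a subgraph of $H$ whose set of odd-degree vertices is exactly $T$ (loops count twice towards the degree). A $T$-cut is a cut $\delta(U)=\{uv\in E(H): u\in U, v\notin U\}$ where $U\subseteq V(H)$ and $|U\cap T|$ is odd. *)

theory Defs
  imports Complex_Main "HOL-Library.Extended_Nat"
begin

text \<open>Finite undirected graphs with loops and parallel edges: the edges are abstract names, and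
  \<open>ends\<close> maps an edge to its set of end vertices, a singleton precisely for a loop.\<close>

locale finite_multigraph =
  fixes V :: "'v set" and E :: "'e set" and ends :: "'e \<Rightarrow> 'v set"
  assumes finite_V: "finite V"
    and finite_E: "finite E"
    and ends_subset: "e \<in> E \<Longrightarrow> ends e \<subseteq> V"
    and ends_card: "e \<in> E \<Longrightarrow> card (ends e) \<in> {1, 2}"

locale graft = finite_multigraph V E ends
  for V :: "'v set" and E :: "'e set" and ends :: "'e \<Rightarrow> 'v set" +
  fixes T :: "'v set"
  assumes T_subset: "T \<subseteq> V"
    and even_card_T: "even (card T)"

text \<open>The second summand makes a loop count twice.\<close>

definition degree :: "('e \<Rightarrow> 'v set) \<Rightarrow> 'e set \<Rightarrow> 'v \<Rightarrow> nat" where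
  "degree ends F v = card {e \<in> F. v \<in> ends e} + card {e \<in> F. ends e = {v}}"

definition T_join :: "'v set \<Rightarrow> 'e set \<Rightarrow> ('e \<Rightarrow> 'v set) \<Rightarrow> 'v set \<Rightarrow> 'e set \<Rightarrow> bool" where
  "T_join V E ends T J \<longleftrightarrow> J \<subseteq> E \<and> {v \<in> V. odd (degree ends J v)} = T"

definition cut :: "'e set \<Rightarrow> ('e \<Rightarrow> 'v set) \<Rightarrow> 'v set \<Rightarrow> 'e set" where
  "cut E ends U = {e \<in> E. \<exists>u v. ends e = {u, v} \<and> u \<in> U \<and> v \<notin> U}"

definition T_cut :: "'v set \<Rightarrow> 'e set \<Rightarrow> ('e \<Rightarrow> 'v set) \<Rightarrow> 'v set \<Rightarrow> 'e set \<Rightarrow> bool" where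
  "T_cut V E ends T C \<longleftrightarrow> (\<exists>U \<subseteq> V. odd (card (U \<inter> T)) \<and> C = cut E ends U)"

definition T_join_packing ::
  "'v set \<Rightarrow> 'e set \<Rightarrow> ('e \<Rightarrow> 'v set) \<Rightarrow> 'v set \<Rightarrow> nat \<Rightarrow> (nat \<Rightarrow> 'e set) \<Rightarrow> bool" where
  "T_join_packing V E ends T k J \<longleftrightarrow>
     (\<forall>i<k. T_join V E ends T (J i)) \<and> (\<forall>i<k. \<forall>j<k. i \<noteq> j \<longrightarrow> J i \<inter> J j = {})"

text \<open>Both optima are taken in \<^typ>\<open>enat\<close> to cover \<open>T = {}\<close>: then there is no \<open>T\<close>-cut, so the
  minimum is \<open>\<infinity>\<close>, while the empty set is a \<open>T\<close>-join which may be repeated indefinitely in a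
  packing (packings are indexed families), so the maximum is \<open>\<infinity>\<close> as well. For \<open>T \<noteq> {}\<close> both
  are finite and attained; see the lemmas below.\<close>

definition max_T_joins :: "'v set \<Rightarrow> 'e set \<Rightarrow> ('e \<Rightarrow> 'v set) \<Rightarrow> 'v set \<Rightarrow> enat" where
  "max_T_joins V E ends T = Sup {enat k | k. \<exists>J. T_join_packing V E ends T k J}"

definition min_T_cut :: "'v set \<Rightarrow> 'e set \<Rightarrow> ('e \<Rightarrow> 'v set) \<Rightarrow> 'v set \<Rightarrow> enat" where
  "min_T_cut V E ends T = Inf {enat (card C) | C. T_cut V E ends T C}"

context graft
begin

lemma packing_bound:
  assumes "T \<noteq> {}" and p: "T_join_packing V E ends T k J"
  shows "k \<le> card E"
proof -
  have "J i \<noteq> {}" "J i \<subseteq> E" if "i < k" for i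
    using that p assms(1) by (auto simp: T_join_packing_def T_join_def degree_def)
  then have "\<forall>i<k. \<exists>e. e \<in> J i \<and> e \<in> E" by blast
  then obtain f where f: "\<And>i. i < k \<Longrightarrow> f i \<in> J i \<and> f i \<in> E" by metis
  have "inj_on f {..<k}"
    using f p unfolding inj_on_def T_join_packing_def by (metis disjoint_iff lessThan_iff)
  then have "card {..<k} \<le> card E"
    using f finite_E by (intro card_inj_on_le[of f]) auto
  then show ?thesis by simp
qed

lemma max_T_joins_eq_Max:
  assumes "T \<noteq> {}"
  shows "max_T_joins V E ends T = enat (Max {k. \<exists>J. T_join_packing V E ends T k J})"
    and "finite {k. \<exists>J. T_join_packing V E ends T k J}"
    and "{k. \<exists>J. T_join_packing V E ends T k J} \<noteq> {}"
proof -
  let ?K = "{k. \<exists>J. T_join_packing V E ends T k J}"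
  have sub: "?K \<subseteq> {..card E}" using packing_bound[OF assms] by auto
  show fin: "finite ?K" by (rule finite_subset[OF sub]) simp
  have "T_join_packing V E ends T 0 J" for J by (simp add: T_join_packing_def)
  then show ne: "?K \<noteq> {}" by blast
  have "{enat k | k. \<exists>J. T_join_packing V E ends T k J} = enat ` ?K" by auto
  moreover have "Sup (enat ` ?K) = enat (Max ?K)"
  proof (rule antisym)
    show "Sup (enat ` ?K) \<le> enat (Max ?K)"
      by (rule Sup_least) (auto intro!: Max_ge fin[simplified])
    show "enat (Max ?K) \<le> Sup (enat ` ?K)"
      by (rule Sup_upper, rule imageI, rule Max_in[OF fin ne])
  qed
  ultimately show "max_T_joins V E ends T = enat (Max ?K)"
    by (simp add: max_T_joins_def)
qed

lemma min_T_cut_eq_Min: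
  assumes "T \<noteq> {}"
  shows "min_T_cut V E ends T = enat (Min {card C | C. T_cut V E ends T C})"
    and "finite {card C | C. T_cut V E ends T C}"
    and "{card C | C. T_cut V E ends T C} \<noteq> {}"
proof -
  let ?K = "{card C | C. T_cut V E ends T C}"
  have sub: "?K \<subseteq> {..card E}"
    by (auto simp: T_cut_def cut_def intro!: card_mono finite_E)
  show fin: "finite ?K" by (rule finite_subset[OF sub]) simp
  obtain t where t: "t \<in> T" using assms by blast
  have "T_cut V E ends T (cut E ends {t})"
    unfolding T_cut_def using t T_subset by (intro exI[of _ "{t}"]) auto
  then show ne: "?K \<noteq> {}" by blast
  have "{enat (card C) | C. T_cut V E ends T C} = enat ` ?K" by auto
  moreover have "Inf (enat ` ?K) = enat (Min ?K)"
  proof (rule antisym)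
    show "Inf (enat ` ?K) \<le> enat (Min ?K)"
      by (rule Inf_lower, rule imageI, rule Min_in[OF fin ne])
    show "enat (Min ?K) \<le> Inf (enat ` ?K)"
      by (rule Inf_greatest) (use fin in \<open>auto intro!: Min_le\<close>)
  qed
  ultimately show "min_T_cut V E ends T = enat (Min ?K)"
    by (simp add: min_T_cut_def)
qed

end

end

theory Submission
  imports Defs
begin

text \<open>Let \<open>k\<close> be the minimum size of a \<open>T\<close>-cut. By the degree hypotheses every \<open>T\<close>-cut has the
  parity of \<open>k\<close>. If a vertex \<open>v\<close> has positive degree and is outside \<open>T\<close>, or has degree more than \<open>k\<close>
  and is in \<open>T\<close>, then two edges \<open>vs\<close>, \<open>vt\<close> can be replaced by a single edge \<open>st\<close> without creating a
  \<open>T\<close>-cut smaller than \<open>k\<close>: otherwise, for a fixed \<open>vs\<close>, each \<open>t\<close> lies together with \<open>s\<close> in a set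
  avoiding \<open>v\<close> whose boundary is a \<open>T\<close>-cut of size \<open>k\<close>. Such sets are closed under union, so one of
  them contains all neighbours of \<open>v\<close>, and adding \<open>v\<close> to it decreases its boundary too much.
  Packings lift back through splitting. When no splitting is possible, and loops are discarded, all
  edges run inside \<open>T\<close> and all vertices of \<open>T\<close> have degree \<open>k\<close>. As \<open>card T \<le> 4\<close>, such a graph
  decomposes into \<open>k\<close> perfect matchings: any edge extends to a perfect matching by degree counting.\<close>

section \<open>Degrees and cuts as sums over edges\<close>

text \<open>Contribution of an edge with end set \<open>A\<close> to the degree of \<open>v\<close>,
  a loop giving 2. Writing degrees and cut sizes as sums over edges lets identities and inequalities
  between them be checked edge by edge.\<close>

definition inc :: "'v set \<Rightarrow> 'v \<Rightarrow> nat" where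
  "inc A v = of_bool (v \<in> A) + of_bool (A = {v})"

text \<open>Unlike the existential in \<open>cut\<close>, this form does not choose which end lies
  inside, so a case analysis on the membership of the two ends suffices. A loop never
  crosses.\<close>

definition crosses :: "'v set \<Rightarrow> 'v set \<Rightarrow> bool" where
  "crosses A U \<longleftrightarrow> A \<inter> U \<noteq> {} \<and> \<not> A \<subseteq> U"

lemma inc_pair: "inc {x, y} v = of_bool (v = x) + of_bool (v = y)"
  by (auto simp: inc_def of_bool_def)

lemma inc_singleton: "inc {x} v = of_bool (v = x) + of_bool (v = x)"
  using inc_pair[of x x v] by simp

lemma crosses_pair: "crosses {x, y} U \<longleftrightarrow> (x \<in> U) \<noteq> (y \<in> U)"
  by (auto simp: crosses_def)

lemma card_1_or_2_pairE:
  assumes "card A \<in> {1, 2}"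
  obtains x y where "A = {x, y}"
proof -
  have "(\<exists>x. A = {x, x}) \<or> (\<exists>x y. A = {x, y})"
    using assms by (auto simp: card_1_singleton_iff card_2_iff)
  then show thesis using that by blast
qed

lemma pair_containingE:
  assumes "card A \<in> {1, 2}" "v \<in> A"
  obtains y where "A = {v, y}"
  using assms by (metis card_1_or_2_pairE insertE insert_commute singletonD)

lemma degree_eq_sum:
  assumes "finite F"
  shows "degree ends F v = (\<Sum>e\<in>F. inc (ends e) v)"
  using assms by (simp add: degree_def inc_def sum.distrib sum_of_bool_eq Collect_conj_eq)

lemma card_cut_eq_sum:
  assumes "finite F" "\<And>e. e \<in> F \<Longrightarrow> card (ends e) \<in> {1, 2}"
  shows "card (cut F ends U) = (\<Sum>e\<in>F. of_bool (crosses (ends e) U))"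
proof -
  have "(\<exists>u v. ends e = {u, v} \<and> u \<in> U \<and> v \<notin> U) \<longleftrightarrow> crosses (ends e) U" if e: "e \<in> F" for e
  proof -
    obtain x y where xy: "ends e = {x, y}" using assms(2)[OF e] by (rule card_1_or_2_pairE)
    show ?thesis unfolding xy crosses_pair by (auto simp: doubleton_eq_iff)
  qed
  then have "cut F ends U = F \<inter> {e. crosses (ends e) U}"
    by (auto simp: cut_def)
  with assms(1) show ?thesis by (simp add: sum_of_bool_eq)
qed

text \<open>Handshake argument relative to \<open>U\<close>: an edge adds to the degree sum the
  number of its ends in \<open>U\<close>, counted with multiplicity, and this is odd exactly if the
  edge crosses.\<close>

lemma even_cut_plus_degrees:
  assumes "finite U" "finite F" "\<And>e. e \<in> F \<Longrightarrow> card (ends e) \<in> {1, 2}"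
  shows "even (card (cut F ends U) + (\<Sum>v\<in>U. degree ends F v))"
proof -
  have "(\<Sum>v\<in>U. degree ends F v) = (\<Sum>e\<in>F. \<Sum>v\<in>U. inc (ends e) v)"
    using assms(2) by (simp add: degree_eq_sum) (rule sum.swap)
  then have eq: "card (cut F ends U) + (\<Sum>v\<in>U. degree ends F v)
      = (\<Sum>e\<in>F. of_bool (crosses (ends e) U) + (\<Sum>v\<in>U. inc (ends e) v))"
    using assms by (simp add: card_cut_eq_sum sum.distrib)
  have "even (of_bool (crosses (ends e) U) + (\<Sum>v\<in>U. inc (ends e) v))" if e: "e \<in> F" for e
  proof -
    obtain x y where xy: "ends e = {x, y}" using assms(3)[OF e] by (rule card_1_or_2_pairE)
    show ?thesis unfolding xy inc_pair crosses_pair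
      using assms(1) by (simp add: sum.distrib of_bool_def)
  qed
  then show ?thesis unfolding eq by (simp add: dvd_sum)
qed

section \<open>Weak duality\<close>

text \<open>The handshake argument applied to \<open>J\<close> alone: \<open>U\<close> contains an
  odd number of vertices of odd \<open>J\<close>-degree, so an odd number of edges of
  \<open>J\<close> leave \<open>U\<close>.\<close>

lemma T_join_meets_cut:
  assumes "graft V E ends T" "T_join V E ends T J" "U \<subseteq> V" "odd (card (U \<inter> T))"
  shows "J \<inter> cut E ends U \<noteq> {}"
proof -
  interpret graft V E ends T by fact
  have J: "J \<subseteq> E" and deg: "\<And>v. v \<in> V \<Longrightarrow> odd (degree ends J v) \<longleftrightarrow> v \<in> T"
    using assms(2) by (auto simp: T_join_def)
  have fin: "finite J" "finite U" using J finite_E assms(3) finite_V finite_subset by blast+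
  have "U \<inter> T = {v \<in> U. odd (degree ends J v)}" using deg assms(3) by auto
  then have "odd (\<Sum>v\<in>U. degree ends J v)"
    using assms(4) fin by (simp add: even_sum_iff)
  moreover have "even (card (cut J ends U) + (\<Sum>v\<in>U. degree ends J v))"
    using fin J ends_card by (intro even_cut_plus_degrees) auto
  ultimately have "cut J ends U \<noteq> {}" by auto
  then show ?thesis using J unfolding cut_def by blast
qed

text \<open>Disjoint joins pick distinct edges of \<open>C\<close>.\<close>

lemma packing_le_T_cut:
  assumes "graft V E ends T" "T_join_packing V E ends T k J" "T_cut V E ends T C"
  shows "k \<le> card C"
proof -
  obtain U where U: "U \<subseteq> V" "odd (card (U \<inter> T))" "C = cut E ends U"
    using assms(3) by (auto simp: T_cut_def)
  have "\<exists>e. e \<in> J i \<inter> C" if "i < k" for i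
    using T_join_meets_cut[OF assms(1) _ U(1,2)] that assms(2) U(3)
    by (fastforce simp: T_join_packing_def)
  then obtain f where f: "\<And>i. i < k \<Longrightarrow> f i \<in> J i \<inter> C" by metis
  have "inj_on f {..<k}"
    using f assms(2) unfolding inj_on_def T_join_packing_def
    by (metis Int_iff disjoint_iff lessThan_iff)
  moreover have "finite C"
    using U(3) assms(1) by (simp add: cut_def graft_def finite_multigraph_def)
  ultimately have "card {..<k} \<le> card C" using f by (intro card_inj_on_le[of f]) auto
  then show ?thesis by simp
qed

section \<open>Regular graphs on at most four terminals\<close>

text \<open>Induction on \<open>k\<close>: a perfect matching of \<open>T\<close> is a
  \<open>T\<close>-join, and removing it leaves a graph that is regular of degree one less.\<close>

lemma regular_packing:
  assumes "finite T" "even (card T)" "card T \<le> 4" "T \<noteq> {}" "T \<subseteq> V" "finite E"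
    and "\<And>e. e \<in> E \<Longrightarrow> card (ends e) = 2 \<and> ends e \<subseteq> T"
    and "\<And>v. v \<in> T \<Longrightarrow> degree ends E v = k"
  shows "\<exists>J. T_join_packing V E ends T k J"
  using assms(6-8)
proof (induction k arbitrary: E)
  case 0
  then show ?case by (simp add: T_join_packing_def)
next
  case (Suc k)
  note fin = Suc.prems(1) and edges = Suc.prems(2) and deg = Suc.prems(3)
  obtain t where "t \<in> T" using assms(4) by blast
  then have "degree ends E t \<noteq> 0" using deg by simp
  then have "E \<noteq> {}" by (auto simp: degree_def)
  then obtain e where e: "e \<in> E" by blast
  then obtain a b where ab: "ends e = {a, b}" "a \<noteq> b" "a \<in> T" "b \<in> T"
    using edges[OF e] by (auto simp: card_2_iff)
  \<comment> \<open>The degree condition says that \<open>M\<close> is a perfect matching of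
    \<open>T\<close>. It consists of \<open>e\<close> alone if \<open>T\<close> has two elements,
    and of \<open>e\<close> and an edge joining the other two elements if \<open>T\<close> has
    four.\<close>
  obtain M where M: "M \<subseteq> E" "\<And>v. degree ends M v = of_bool (v \<in> T)"
  proof (cases "T = {a, b}")
    case True
    have "degree ends {e} v = of_bool (v \<in> T)" for v
      using True ab by (subst degree_eq_sum) (auto simp: inc_pair)
    then show thesis using e by (intro that[of "{e}"]) auto
  next
    case False
    have "card (T - {a, b}) = card T - 2" using ab by (subst card_Diff_subset) auto
    moreover have "card (T - {a, b}) \<noteq> 0"
    proof -
      have "T - {a, b} \<noteq> {}" using False ab(3,4) by blast
      then show ?thesis using assms(1) by (metis card_0_eq finite_Diff)
    qed
    ultimately have "card (T - {a, b}) = 2" using assms(2,3) by presburger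
    then obtain c d where cd: "T - {a, b} = {c, d}" "c \<noteq> d" by (auto simp: card_2_iff)
    then have T: "T = {a, b, c, d}" "c \<noteq> a" "c \<noteq> b" "d \<noteq> a" "d \<noteq> b" using ab by auto
    \<comment> \<open>Otherwise every edge at \<open>c\<close> or \<open>d\<close> leads to \<open>a\<close> or \<open>b\<close>, whose degrees also count \<open>e\<close>.\<close>
    have "\<exists>f\<in>E. ends f = {c, d}"
    proof (rule ccontr)
      assume no: "\<not> (\<exists>f\<in>E. ends f = {c, d})"
      have "(\<Sum>f\<in>E. inc (ends f) c + inc (ends f) d) < (\<Sum>f\<in>E. inc (ends f) a + inc (ends f) b)"
      proof (rule sum_strict_mono_ex1)
        show "\<forall>f\<in>E. inc (ends f) c + inc (ends f) d \<le> inc (ends f) a + inc (ends f) b"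
        proof
          fix f assume f: "f \<in> E"
          obtain x y where xy: "ends f = {x, y}" "x \<noteq> y" "x \<in> T" "y \<in> T"
            using edges[OF f] by (auto simp: card_2_iff)
          have "{x, y} \<noteq> {c, d}" using no f xy by auto
          moreover have "x = a \<or> x = b \<or> x = c \<or> x = d" "y = a \<or> y = b \<or> y = c \<or> y = d"
            using xy T(1) by auto
          ultimately show "inc (ends f) c + inc (ends f) d \<le> inc (ends f) a + inc (ends f) b"
            using xy(2) T(2-) ab(2) cd(2) unfolding xy(1) inc_pair
            by (elim disjE) (simp_all add: insert_commute)
        qed
        show "\<exists>f\<in>E. inc (ends f) c + inc (ends f) d < inc (ends f) a + inc (ends f) b"
          using e T ab by (intro bexI[of _ e]) (auto simp: inc_pair)
      qed (fact fin)
      then have "degree ends E c + degree ends E d < degree ends E a + degree ends E b"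
        by (simp add: degree_eq_sum fin sum.distrib)
      then show False using deg T by simp
    qed
    then obtain f where f: "f \<in> E" "ends f = {c, d}" by blast
    then have "e \<noteq> f" using ab T by auto
    then have "degree ends {e, f} v = of_bool (v \<in> T)" for v
      using f ab T cd(2) by (subst degree_eq_sum) (auto simp: inc_pair)
    then show thesis using e f by (intro that[of "{e, f}"]) auto
  qed
  have split: "degree ends E v = degree ends (E - M) v + degree ends M v" for v
    using fin M(1) by (simp add: degree_eq_sum finite_subset sum.subset_diff)
  have "\<exists>J. T_join_packing V (E - M) ends T k J"
    using fin edges deg split M by (intro Suc.IH) fastforce+
  then obtain J where J: "T_join_packing V (E - M) ends T k J" by blast
  have join: "T_join V E ends T M"
    using M assms(5) by (auto simp: T_join_def)
  have "T_join_packing V E ends T (Suc k) (J(k := M))"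
    unfolding T_join_packing_def
  proof (intro conjI allI impI)
    have sub: "J i \<subseteq> E - M" if "i < k" for i
      using J that by (auto simp: T_join_packing_def T_join_def)
    show "T_join V E ends T ((J(k := M)) i)" if "i < Suc k" for i
    proof (cases "i = k")
      case False
      then have "T_join V (E - M) ends T (J i)"
        using that J by (simp add: T_join_packing_def)
      then show ?thesis using False unfolding T_join_def by auto
    qed (simp add: join)
    show "(J(k := M)) i \<inter> (J(k := M)) j = {}" if "i < Suc k" "j < Suc k" "i \<noteq> j" for i j
      using that J sub[of i] sub[of j]
      by (cases "i = k"; cases "j = k") (auto simp: T_join_packing_def)
  qed
  then show ?case by blast
qed

section \<open>Tight cuts and splitting off\<close>

text \<open>Uncrossing: as \<open>X\<close> and \<open>Y\<close> are \<open>T\<close>-odd, either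
  both differences are \<open>T\<close>-odd or both the intersection and the union are.
  Posimodularity of the cut function excludes the first case, and submodularity gives tightness in
  the second.\<close>

lemma tight_union:
  assumes "graft V E ends T"
    and min: "\<And>U. U \<subseteq> V \<Longrightarrow> odd (card (U \<inter> T)) \<Longrightarrow> k \<le> card (cut E ends U)"
    and X: "X \<subseteq> V" "odd (card (X \<inter> T))" "card (cut E ends X) = k"
    and Y: "Y \<subseteq> V" "odd (card (Y \<inter> T))" "card (cut E ends Y) = k"
    and e: "e \<in> E" "ends e = {v, s}" "s \<in> X \<inter> Y" "v \<notin> X \<union> Y"
  shows "odd (card ((X \<union> Y) \<inter> T))" "card (cut E ends (X \<union> Y)) = k"
proof -
  interpret graft V E ends T by fact
  have finT: "finite T" using T_subset finite_V finite_subset by blast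
  have cut: "card (cut E ends U) = (\<Sum>e\<in>E. of_bool (crosses (ends e) U))" for U
    using finite_E ends_card by (rule card_cut_eq_sum)
  have X_T: "card (X \<inter> T) = card ((X - Y) \<inter> T) + card (X \<inter> Y \<inter> T)"
    using finT by (subst card_Un_disjoint[symmetric]) (auto intro: arg_cong[of _ _ card])
  have Y_T: "card (Y \<inter> T) = card ((Y - X) \<inter> T) + card (X \<inter> Y \<inter> T)"
    using finT by (subst card_Un_disjoint[symmetric]) (auto intro: arg_cong[of _ _ card])
  have Un_T: "card ((X \<union> Y) \<inter> T) = card (X \<inter> T) + card ((Y - X) \<inter> T)"
    using finT by (subst card_Un_disjoint[symmetric]) (auto intro: arg_cong[of _ _ card])
  \<comment> \<open>The edge \<open>e\<close> makes the inequality for \<open>X - Y\<close> and \<open>Y - X\<close> strict, so these cannot both be odd.\<close>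
  have "(\<Sum>e\<in>E. of_bool (crosses (ends e) (X - Y)) + of_bool (crosses (ends e) (Y - X)))
      < (\<Sum>e\<in>E. of_bool (crosses (ends e) X) + of_bool (crosses (ends e) Y) :: nat)"
  proof (rule sum_strict_mono_ex1)
    show "\<forall>e\<in>E. of_bool (crosses (ends e) (X - Y)) + of_bool (crosses (ends e) (Y - X))
        \<le> (of_bool (crosses (ends e) X) + of_bool (crosses (ends e) Y) :: nat)"
    proof
      fix e assume "e \<in> E"
      then obtain x y where "ends e = {x, y}" using ends_card card_1_or_2_pairE by metis
      then show "of_bool (crosses (ends e) (X - Y)) + of_bool (crosses (ends e) (Y - X))
          \<le> (of_bool (crosses (ends e) X) + of_bool (crosses (ends e) Y) :: nat)"
        by (cases "x \<in> X"; cases "y \<in> X"; cases "x \<in> Y"; cases "y \<in> Y") (simp_all add: crosses_pair)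
    qed
    show "\<exists>e\<in>E. of_bool (crosses (ends e) (X - Y)) + of_bool (crosses (ends e) (Y - X))
        < (of_bool (crosses (ends e) X) + of_bool (crosses (ends e) Y) :: nat)"
      using e by (intro bexI[of _ e]) (auto simp: crosses_pair)
  qed (fact finite_E)
  then have "card (cut E ends (X - Y)) + card (cut E ends (Y - X)) < k + k"
    using X(3) Y(3) by (simp add: cut sum.distrib)
  then have "\<not> (odd (card ((X - Y) \<inter> T)) \<and> odd (card ((Y - X) \<inter> T)))"
    using min[of "X - Y"] min[of "Y - X"] X(1) Y(1)
    by (meson Diff_subset add_mono leD subset_trans)
  then have "odd (card (X \<inter> Y \<inter> T))" and odd_Un: "odd (card ((X \<union> Y) \<inter> T))"
    using X(2) Y(2) unfolding X_T Y_T Un_T by auto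
  \<comment> \<open>Submodularity: the two cuts together have at most \<open>2 * k\<close> edges and
    each has at least \<open>k\<close>, so both are tight.\<close>
  have "(\<Sum>e\<in>E. of_bool (crosses (ends e) (X \<inter> Y)) + of_bool (crosses (ends e) (X \<union> Y)))
      \<le> (\<Sum>e\<in>E. of_bool (crosses (ends e) X) + of_bool (crosses (ends e) Y) :: nat)"
  proof (rule sum_mono)
    fix e assume "e \<in> E"
    then obtain x y where "ends e = {x, y}" using ends_card card_1_or_2_pairE by metis
    then show "of_bool (crosses (ends e) (X \<inter> Y)) + of_bool (crosses (ends e) (X \<union> Y))
        \<le> (of_bool (crosses (ends e) X) + of_bool (crosses (ends e) Y) :: nat)"
      by (cases "x \<in> X"; cases "y \<in> X"; cases "x \<in> Y"; cases "y \<in> Y") (simp_all add: crosses_pair)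
  qed
  then have "card (cut E ends (X \<inter> Y)) + card (cut E ends (X \<union> Y)) \<le> k + k"
    using X(3) Y(3) by (simp add: cut sum.distrib)
  moreover have "k \<le> card (cut E ends (X \<inter> Y))" "k \<le> card (cut E ends (X \<union> Y))"
    using \<open>odd (card (X \<inter> Y \<inter> T))\<close> odd_Un X(1) Y(1) by (auto intro!: min)
  ultimately show "card (cut E ends (X \<union> Y)) = k" by linarith
  show "odd (card ((X \<union> Y) \<inter> T))" by (fact odd_Un)
qed

text \<open>The conclusion excludes exactly the tight sets whose cut would lose both
  \<open>e\<close> and \<open>f\<close> when these are replaced by one edge \<open>st\<close>. If
  every partner \<open>f\<close> of a fixed \<open>e\<close> were obstructed, the obstructing sets
  would merge into one tight set containing all neighbours of \<open>v\<close>.\<close>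

lemma splittable_pair_exists:
  assumes "graft V E ends T"
    and min: "\<And>U. U \<subseteq> V \<Longrightarrow> odd (card (U \<inter> T)) \<Longrightarrow> k \<le> card (cut E ends U)"
    and loopless: "\<And>e. e \<in> E \<Longrightarrow> card (ends e) = 2"
    and v: "v \<in> V" "2 \<le> degree ends E v" "v \<in> T \<Longrightarrow> k < degree ends E v"
  obtains e f s t where "e \<in> E" "f \<in> E" "e \<noteq> f" "ends e = {v, s}" "ends f = {v, t}"
    "\<forall>X\<subseteq>V. v \<notin> X \<longrightarrow> s \<in> X \<longrightarrow> t \<in> X \<longrightarrow> odd (card (X \<inter> T)) \<longrightarrow> card (cut E ends X) \<noteq> k"
proof (rule ccontr)
  assume "\<not> thesis"
  note none = that and contra = this
  interpret graft V E ends T by fact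
  have cut: "card (cut E ends U) = (\<Sum>e\<in>E. of_bool (crosses (ends e) U))" for U
    using finite_E ends_card by (rule card_cut_eq_sum)
  define D where "D = {e \<in> E. v \<in> ends e}"
  have finD: "finite D" using finite_E by (simp add: D_def)
  have "{e \<in> E. ends e = {v}} = {}" using loopless by fastforce
  then have "degree ends E v = card D"
    unfolding degree_def D_def by (simp only: card.empty add_0_right)
  then have "2 \<le> card D" using v(2) by simp
  then obtain e where eD: "e \<in> D" by fastforce
  then have e: "e \<in> E" "v \<in> ends e" by (auto simp: D_def)
  then obtain s where s: "ends e = {v, s}" using pair_containingE ends_card by metis
  have sv: "s \<noteq> v" using loopless[OF e(1)] s by auto
  have bad: "\<exists>X\<subseteq>V. v \<notin> X \<and> s \<in> X \<and> t \<in> X \<and> odd (card (X \<inter> T)) \<and> card (cut E ends X) = k"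
    if "f \<in> E" "f \<noteq> e" "ends f = {v, t}" for f t
    using none[of e f s t] contra that e s by blast
  \<comment> \<open>The obstructing sets are merged one edge at a time; all of them contain
    \<open>s\<close> and avoid \<open>v\<close>, so \<open>e\<close> serves as the edge that
    \<open>tight_union\<close> asks for.\<close>
  have "\<exists>X\<subseteq>V. v \<notin> X \<and> s \<in> X \<and> (\<forall>f\<in>A. ends f \<subseteq> insert v X) \<and>
      odd (card (X \<inter> T)) \<and> card (cut E ends X) = k"
    if "finite A" "A \<noteq> {}" "A \<subseteq> D - {e}" for A
    using that
  proof (induction A rule: finite_ne_induct)
    case (singleton f)
    then have f: "f \<in> E" "v \<in> ends f" "f \<noteq> e" by (auto simp: D_def)
    then obtain t where t: "ends f = {v, t}" using pair_containingE ends_card by metis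
    show ?case using bad[OF f(1,3) t] t by auto
  next
    case (insert f A)
    then obtain Y where Y: "Y \<subseteq> V" "v \<notin> Y" "s \<in> Y" "\<forall>f\<in>A. ends f \<subseteq> insert v Y"
      "odd (card (Y \<inter> T))" "card (cut E ends Y) = k" by auto
    have f: "f \<in> E" "v \<in> ends f" "f \<noteq> e" using insert by (auto simp: D_def)
    then obtain t where t: "ends f = {v, t}" using pair_containingE ends_card by metis
    obtain X where X: "X \<subseteq> V" "v \<notin> X" "s \<in> X" "t \<in> X"
      "odd (card (X \<inter> T))" "card (cut E ends X) = k"
      using bad[OF f(1,3) t] by blast
    have "odd (card ((X \<union> Y) \<inter> T))" "card (cut E ends (X \<union> Y)) = k"
      by (rule tight_union[OF assms(1) min X(1,5,6) Y(1,5,6) e(1) s]; use X Y in simp)+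
    then show ?case using X Y t by (intro exI[of _ "X \<union> Y"]) auto
  qed
  \<comment> \<open>A second edge at \<open>v\<close> is what provides a tight set at all.\<close>
  moreover have "D - {e} \<noteq> {}"
  proof
    assume "D - {e} = {}"
    then have "card D \<le> card {e}" by (intro card_mono) auto
    then show False using \<open>2 \<le> card D\<close> by simp
  qed
  ultimately obtain X where X: "X \<subseteq> V" "v \<notin> X" "s \<in> X" "\<forall>f\<in>D - {e}. ends f \<subseteq> insert v X"
      "odd (card (X \<inter> T))" "card (cut E ends X) = k"
    using finD by (metis finite_Diff subset_refl)
  \<comment> \<open>Every edge at \<open>v\<close> has its other end in \<open>X\<close>, so it
    crosses \<open>X\<close> but not \<open>insert v X\<close>; the remaining edges do not notice
    \<open>v\<close>.\<close>
  have "(\<Sum>f\<in>E. of_bool (crosses (ends f) X))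
      = (\<Sum>f\<in>E. of_bool (crosses (ends f) (insert v X)) + inc (ends f) v)"
  proof (rule sum.cong)
    fix f assume f: "f \<in> E"
    obtain x y where xy: "ends f = {x, y}" "x \<noteq> y" using loopless[OF f] by (auto simp: card_2_iff)
    have "v \<in> ends f \<Longrightarrow> ends f \<subseteq> insert v X" using X(3,4) f s by (cases "f = e") (auto simp: D_def)
    then show "of_bool (crosses (ends f) X)
        = of_bool (crosses (ends f) (insert v X)) + inc (ends f) v"
      using xy(2) X(2) unfolding xy(1) crosses_pair inc_pair by (auto simp: of_bool_def)
  qed simp
  then have eq: "k = card (cut E ends (insert v X)) + degree ends E v"
    using X(6) by (simp add: cut sum.distrib degree_eq_sum finite_E)
  \<comment> \<open>If \<open>v\<close> is in \<open>T\<close>, its degree alone exceeds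
    \<open>k\<close>; otherwise \<open>insert v X\<close> is still \<open>T\<close>-odd and its cut
    already has \<open>k\<close> edges.\<close>
  show False
  proof (cases "v \<in> T")
    case True
    then show False using eq v(3) by simp
  next
    case False
    then have "k \<le> card (cut E ends (insert v X))" using X v(1) by (intro min) auto
    then show False using eq v(2) by simp
  qed
qed

text \<open>The new edge \<open>st\<close> reuses the name \<open>e\<close>, and \<open>f\<close> is
  deleted. In a join it is replaced by the path \<open>s\<close>, \<open>v\<close>,
  \<open>t\<close>, which adds 2 to the degree of \<open>v\<close>. At most one join uses
  \<open>e\<close>, so only that one receives \<open>f\<close>.\<close>

lemma packing_of_split_packing:
  assumes "finite E" "e \<in> E" "f \<in> E" "e \<noteq> f" "ends e = {v, s}" "ends f = {v, t}"
    and J: "T_join_packing V (E - {f}) (ends(e := {s, t})) T k J"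
  shows "\<exists>J. T_join_packing V E ends T k J"
proof -
  define lift where "lift F = (if e \<in> F then insert f F else F)" for F
  have parity: "even (degree ends (lift F) w) = even (degree (ends(e := {s, t})) F w)"
    if F: "F \<subseteq> E - {f}" for F w
  proof -
    have fin: "finite F" using F assms(1) finite_subset by blast
    show ?thesis
    proof (cases "e \<in> F")
      case True
      then obtain G where G: "F = insert e G" "e \<notin> G" by (meson Set.set_insert)
      have eq: "(\<Sum>x\<in>G. inc ((ends(e := {s, t})) x) w) = (\<Sum>x\<in>G. inc (ends x) w)"
        using G(2) by (intro sum.cong) auto
      have "f \<notin> G" "finite G" using F G fin by auto
      then have "degree ends (lift F) w
          = degree (ends(e := {s, t})) F w + (of_bool (w = v) + of_bool (w = v))"
        using G assms(4-6) eq True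
        by (simp add: lift_def degree_eq_sum inc_pair inc_singleton)
      then show ?thesis by simp
    next
      case False
      then have "(\<Sum>x\<in>F. inc ((ends(e := {s, t})) x) w) = (\<Sum>x\<in>F. inc (ends x) w)"
        by (intro sum.cong) auto
      then show ?thesis using False fin by (simp add: lift_def degree_eq_sum)
    qed
  qed
  have "T_join_packing V E ends T k (\<lambda>i. lift (J i))"
    unfolding T_join_packing_def
  proof (intro conjI allI impI)
    have J_sub: "J i \<subseteq> E - {f}" if "i < k" for i
      using J that by (auto simp: T_join_packing_def T_join_def)
    show "T_join V E ends T (lift (J i))" if "i < k" for i
    proof -
      have "{w \<in> V. odd (degree (ends(e := {s, t})) (J i) w)} = T"
        using J that by (auto simp: T_join_packing_def T_join_def)
      moreover have "lift (J i) \<subseteq> E" using J_sub[OF that] assms(3) by (auto simp: lift_def)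
      ultimately show ?thesis by (simp add: T_join_def parity[OF J_sub[OF that]])
    qed
    show "lift (J i) \<inter> lift (J j) = {}" if ij: "i < k" "j < k" "i \<noteq> j" for i j
    proof -
      have "J i \<inter> J j = {}" using J ij by (auto simp: T_join_packing_def)
      then show ?thesis using J_sub[OF ij(1)] J_sub[OF ij(2)] by (auto simp: lift_def)
    qed
  qed
  then show ?thesis by blast
qed

section \<open>Induction on the number of edges\<close>

text \<open>The number \<open>k\<close> is a fixed lower bound to which the degree parities are
  tied: both conditions survive deleting a loop and splitting a suitable pair, and each of these
  operations removes one edge name.\<close>

lemma packing_exists:
  assumes "graft V E ends T" "card T \<le> 4" "T \<noteq> {}"
    and "\<And>U. U \<subseteq> V \<Longrightarrow> odd (card (U \<inter> T)) \<Longrightarrow> k \<le> card (cut E ends U)"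
    and "\<And>v. v \<in> V \<Longrightarrow> odd (degree ends E v) \<longleftrightarrow> v \<in> T \<and> odd k"
  shows "\<exists>J. T_join_packing V E ends T k J"
  using assms(1,4,5)
proof (induction "card E" arbitrary: E ends rule: less_induct)
  case less
  interpret graft V E ends T by fact
  note min = less.prems(2) and parity = less.prems(3)
  have finT: "finite T" using T_subset finite_V finite_subset by blast
  have cut: "card (cut E ends U) = (\<Sum>e\<in>E. of_bool (crosses (ends e) U))" for U
    using finite_E ends_card by (rule card_cut_eq_sum)
  show ?case
  proof (cases "\<exists>e\<in>E. card (ends e) = 1")
    case True
    then obtain e v where e: "e \<in> E" "ends e = {v}" by (auto simp: card_1_singleton_iff)
    have graft: "graft V (E - {e}) ends T"
      using finite_V finite_E ends_subset ends_card T_subset even_card_T by unfold_locales auto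
    \<comment> \<open>A loop lies in no cut and contributes 2 to a degree.\<close>
    have "cut (E - {e}) ends U = cut E ends U" for U
      using e by (auto simp: cut_def doubleton_eq_iff)
    moreover have "odd (degree ends (E - {e}) w) = odd (degree ends E w)" for w
      using e finite_E by (simp add: degree_eq_sum sum.remove[OF finite_E e(1)] inc_def of_bool_def)
    moreover have "card (E - {e}) < card E" using e(1) finite_E by (rule card_Diff1_less[rotated])
    ultimately obtain J where "T_join_packing V (E - {e}) ends T k J"
      using less.hyps[OF _ graft] min parity by auto
    then have "T_join_packing V E ends T k J"
      unfolding T_join_packing_def T_join_def by blast
    then show ?thesis by blast
  next
    case False
    then have loopless: "card (ends e) = 2" if "e \<in> E" for e
      using ends_card[OF that] that by auto
    show ?thesis
    proof (cases "\<exists>v\<in>V. degree ends E v > (if v \<in> T then k else 0)")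
      case True
      then obtain v where v: "v \<in> V" "degree ends E v > (if v \<in> T then k else 0)" by blast
      \<comment> \<open>Degree 1 is excluded by parity outside \<open>T\<close>, and by exceeding
        \<open>k\<close> inside \<open>T\<close>.\<close>
      have two: "2 \<le> degree ends E v" if "k \<noteq> 0"
      proof (cases "degree ends E v = 1")
        case True
        then show ?thesis using v that parity[OF v(1)] by (auto split: if_splits)
      qed (use v in \<open>auto split: if_splits\<close>)
      show ?thesis
      proof (cases "k = 0")
        case True
        then show ?thesis by (auto simp: T_join_packing_def)
      next
        case False
        have lt: "k < degree ends E v" if "v \<in> T" using v(2) that by simp
        obtain e f s t where ef: "e \<in> E" "f \<in> E" "e \<noteq> f" "ends e = {v, s}" "ends f = {v, t}"
          and not_tight: "\<forall>X\<subseteq>V. v \<notin> X \<longrightarrow> s \<in> X \<longrightarrow> t \<in> X \<longrightarrow> odd (card (X \<inter> T))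
            \<longrightarrow> card (cut E ends X) \<noteq> k"
          by (rule splittable_pair_exists[OF less.prems(1) min loopless v(1) two[OF False] lt];
              (assumption | rule that; assumption))
        let ?E = "E - {f}" and ?ends = "ends(e := {s, t})"
        have st: "{s, t} \<subseteq> V" using ends_subset[OF ef(1)] ends_subset[OF ef(2)] ef(4,5) by auto
        have card_st: "card {s, t} \<in> {1, 2}" by (cases "s = t") auto
        have graft: "graft V ?E ?ends T"
          using finite_V finite_E ends_subset ends_card T_subset even_card_T st card_st
          by unfold_locales (auto split: if_splits)
        \<comment> \<open>The edges \<open>e\<close> and \<open>f\<close> are isolated so that the
          graphs before and after splitting share the remaining sum; it is used with
          \<open>inc\<close> for degrees and with \<open>crosses\<close> for cuts.\<close>
        have sum_E: "(\<Sum>x\<in>E. g x) = g e + g f + (\<Sum>x\<in>E - {e, f}. g x)" for g :: "_ \<Rightarrow> nat"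
          using ef finite_E
          by (simp add: sum.remove[of E e] sum.remove[of "E - {e}" f] Diff_insert2[symmetric]
              insert_commute)
        have sum_E': "(\<Sum>x\<in>?E. g (?ends x)) = g {s, t} + (\<Sum>x\<in>E - {e, f}. g (ends x))"
          for g :: "_ \<Rightarrow> nat"
        proof -
          have "(\<Sum>x\<in>?E. g (?ends x)) = g {s, t} + (\<Sum>x\<in>?E - {e}. g (?ends x))"
            using ef finite_E by (subst sum.remove[of _ e]) auto
          also have "(\<Sum>x\<in>?E - {e}. g (?ends x)) = (\<Sum>x\<in>E - {e, f}. g (ends x))"
            by (intro sum.cong) auto
          finally show ?thesis .
        qed
        have parity': "odd (degree ?ends ?E w) \<longleftrightarrow> w \<in> T \<and> odd k" if "w \<in> V" for w
        proof -
          have "degree ends E w = degree ?ends ?E w + (of_bool (w = v) + of_bool (w = v))"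
            using finite_E sum_E'[of "\<lambda>A. inc A w"] ef
            by (simp add: degree_eq_sum sum_E inc_pair del: fun_upd_apply)
          then show ?thesis using parity[OF that] by simp
        qed
        have min': "k \<le> card (cut ?E ?ends U)" if U: "U \<subseteq> V" "odd (card (U \<inter> T))" for U
        proof -
          interpret split: graft V ?E ?ends T by (fact graft)
          have cut': "card (cut ?E ?ends U) = (\<Sum>e\<in>?E. of_bool (crosses (?ends e) U))"
            using split.finite_E split.ends_card by (rule card_cut_eq_sum)
          have eq: "card (cut E ends U) + of_bool (crosses {s, t} U)
              = card (cut ?E ?ends U) + of_bool (crosses {v, s} U) + of_bool (crosses {v, t} U)"
            using ef unfolding cut' sum_E'[of "\<lambda>A. of_bool (crosses A U)"] cut
            by (simp add: sum_E)
          have le: "k \<le> card (cut E ends U)" using U by (rule min)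
          show ?thesis
          \<comment> \<open>A cut changes size only if \<open>U\<close> separates \<open>v\<close>
            from both \<open>s\<close> and \<open>t\<close>; it then loses two edges, so it must be
            shown to have had at least \<open>k + 2\<close>. Parity rules out \<open>k + 1\<close>,
            and the choice of the pair rules out \<open>k\<close>.\<close>
          proof (cases "(v \<in> U) \<noteq> (s \<in> U) \<and> (v \<in> U) \<noteq> (t \<in> U)")
            case False
            then show ?thesis using eq le by (auto simp: crosses_pair)
          next
            case True
            then have eq2: "card (cut E ends U) = card (cut ?E ?ends U) + 2"
              using eq by (auto simp: crosses_pair)
            have finU: "finite U" using U(1) finite_V finite_subset by blast
            have "{w \<in> U. odd (degree ends E w)} = (if odd k then U \<inter> T else {})"
              using parity U(1) by auto
            then have "odd (\<Sum>w\<in>U. degree ends E w) \<longleftrightarrow> odd k"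
              using finU U(2) by (simp add: even_sum_iff)
            then have cut_parity: "odd (card (cut E ends U)) \<longleftrightarrow> odd k"
              using even_cut_plus_degrees[OF finU finite_E ends_card] by auto
            have "card (cut E ends U) \<noteq> k"
            proof (cases "v \<in> U")
              case False
              then show ?thesis using True U by (intro not_tight[rule_format]) auto
            next
              case v_in: True
              \<comment> \<open>\<open>not_tight\<close> speaks of sets avoiding \<open>v\<close>,
                so the complement is used: it has the same cut and is \<open>T\<close>-odd because
                \<open>card T\<close> is even.\<close>
              have "(V - U) \<inter> T = T - U \<inter> T" using T_subset by auto
              then have "card ((V - U) \<inter> T) = card T - card (U \<inter> T)"
                using finT by (simp add: card_Diff_subset)
              moreover have "card (U \<inter> T) \<le> card T" using finT by (intro card_mono) auto
              ultimately have "odd (card ((V - U) \<inter> T))" using U(2) even_card_T by simp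
              then have "card (cut E ends (V - U)) \<noteq> k"
                using True v_in st by (intro not_tight[rule_format]) auto
              moreover have "card (cut E ends (V - U)) = card (cut E ends U)"
                unfolding cut using ends_subset
                by (intro sum.cong refl) (auto simp: crosses_def of_bool_def)
              ultimately show ?thesis by simp
            qed
            then have "k + 2 \<le> card (cut E ends U)" using le cut_parity
              by (cases "card (cut E ends U) = k + 1") auto
            then show ?thesis using eq2 by simp
          qed
        qed
        have "card ?E < card E" using ef(2) finite_E by (rule card_Diff1_less[rotated])
        then obtain J where "T_join_packing V ?E ?ends T k J"
          using less.hyps[OF _ graft min' parity'] by blast
        then show ?thesis using packing_of_split_packing[OF finite_E ef] by blast
      qed
    next
      case False
      \<comment> \<open>No vertex has excess degree: those outside \<open>T\<close> are isolated,
        and those in \<open>T\<close> have degree exactly \<open>k\<close>, the lower bound coming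
        from the cut around a single vertex.\<close>
      have "ends e \<subseteq> T" if e: "e \<in> E" for e
      proof
        fix v assume v: "v \<in> ends e"
        then have "degree ends E v \<noteq> 0" using e finite_E by (auto simp: degree_def)
        then show "v \<in> T" using False v ends_subset[OF e] by fastforce
      qed
      moreover have "degree ends E v = k" if v: "v \<in> T" for v
      proof (rule antisym)
        show "degree ends E v \<le> k" using False v T_subset by fastforce
        have "cut E ends {v} \<subseteq> {e \<in> E. v \<in> ends e}" by (auto simp: cut_def)
        then have "card (cut E ends {v}) \<le> degree ends E v"
          unfolding degree_def using finite_E by (intro trans_le_add1 card_mono) auto
        moreover have "k \<le> card (cut E ends {v})" using v T_subset by (intro min) auto
        ultimately show "k \<le> degree ends E v" by simp
      qed
      ultimately show ?thesis
        using finT even_card_T assms(2,3) T_subset finite_E loopless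
        by (intro regular_packing) auto
    qed
  qed
qed

section \<open>Equality of maximum and minimum\<close>

theorem corollary1p6:
  fixes V :: "'v set" and E :: "'e set" and ends :: "'e \<Rightarrow> 'v set" and T :: "'v set"
  assumes "graft V E ends T"
    and "card T \<le> 4"
    and "\<forall>v \<in> V - T. even (degree ends E v)"
    and "\<forall>s \<in> T. \<forall>t \<in> T. even (degree ends E s) \<longleftrightarrow> even (degree ends E t)"
  shows "max_T_joins V E ends T = min_T_cut V E ends T"
proof (cases "T = {}")
  case True
  have "T_join_packing V E ends T k (\<lambda>_. {})" for k
    using True by (simp add: T_join_packing_def T_join_def degree_def)
  then have "{enat k |k. \<exists>J. T_join_packing V E ends T k J} = range enat" by auto
  moreover have "Sup (range enat) = \<infinity>"
  proof -
    have "infinite (range enat)"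
      by (metis enat.inject finite_imageD infinite_UNIV_nat inj_onI)
    then show ?thesis by (simp add: Sup_enat_def)
  qed
  ultimately have "max_T_joins V E ends T = \<infinity>" by (simp add: max_T_joins_def)
  moreover have "min_T_cut V E ends T = \<infinity>"
    using True by (simp add: min_T_cut_def T_cut_def top_enat_def)
  ultimately show ?thesis by simp
next
  case False
  interpret graft V E ends T by fact
  define k where "k = Min {card C | C. T_cut V E ends T C}"
  have "k \<in> {card C | C. T_cut V E ends T C}"
    unfolding k_def using min_T_cut_eq_Min[OF False] by (intro Min_in)
  then obtain U where U: "U \<subseteq> V" "odd (card (U \<inter> T))" "k = card (cut E ends U)"
    by (auto simp: T_cut_def)
  have k_le: "k \<le> card C" if "T_cut V E ends T C" for C
    unfolding k_def using min_T_cut_eq_Min(2)[OF False] that by (intro Min_le) auto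
  \<comment> \<open>The minimum cut is given by \<open>U\<close> with
    \<open>card (U \<inter> T)\<close> odd. As all degrees in \<open>T\<close> share one parity and
    the others are even, the degree sum over \<open>U\<close> has this common parity, and the
    handshake argument identifies it with that of \<open>k\<close>.\<close>
  have parity: "odd (degree ends E v) \<longleftrightarrow> v \<in> T \<and> odd k" if v: "v \<in> V" for v
  proof (cases "v \<in> T")
    case True
    have finU: "finite U" using U(1) finite_V finite_subset by blast
    have "{w \<in> U. odd (degree ends E w)} = (if odd (degree ends E v) then U \<inter> T else {})"
      using assms(3) assms(4)[rule_format, OF True] U(1) by auto
    then have "odd (\<Sum>w\<in>U. degree ends E w) \<longleftrightarrow> odd (degree ends E v)"
      using finU U(2) by (simp add: even_sum_iff)
    then show ?thesis
      using even_cut_plus_degrees[OF finU finite_E ends_card] U(3) True by auto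
  qed (use assms(3) v in auto)
  have "k \<le> card (cut E ends X)" if "X \<subseteq> V" "odd (card (X \<inter> T))" for X
    using that by (intro k_le) (auto simp: T_cut_def)
  then have packing: "\<exists>J. T_join_packing V E ends T k J"
    using assms(1,2) False parity by (intro packing_exists) auto
  have "Max {k. \<exists>J. T_join_packing V E ends T k J} = k"
  proof (rule Max_eqI)
    show "finite {k. \<exists>J. T_join_packing V E ends T k J}"
      by (rule max_T_joins_eq_Max(2)[OF False])
    show "k \<in> {k. \<exists>J. T_join_packing V E ends T k J}" using packing by simp
    show "l \<le> k" if l: "l \<in> {k. \<exists>J. T_join_packing V E ends T k J}" for l
      using l packing_le_T_cut[OF assms(1)] U by (auto simp: T_cut_def)
  qed
  then show ?thesis
    using max_T_joins_eq_Max(1)[OF False] min_T_cut_eq_Min(1)[OF False] by (simp add: k_def)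
qed

end
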